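(* Let $(W,\mathcal{F})$ be an opinion space with $\mathcal{F}$ countably infinite, and let $\mathscr{I}$ be a generalized legitimate inaccuracy measure on it. Suppose that $(W,\mathcal{F})$ is W-stable relative to $\mathscr{I}$ and that every coherent credence function on $(W,\mathcal{F})$ has finite expected inaccuracy relative to $\mathscr{I}$. Then for every credence function $c$ on $\mathcal{F}$ the following are equivalent: (1) $c$ is coherent; (2) $c$ is not weakly dominated relative to $\mathscr{I}$ (by any credence function on $\mathcal{F}$).
   Context: An opinion space is a pair $(W,\mathcal{F})$ with $W$ a nonempty set and $\mathcal{F}\subseteq\mathcal{P}(W)$. A credence function on $\mathcal{F}$ is any function $c:\mathcal{F}\to[0,1]$. An algebra over $W$ is a subset of $\mathcal{P}(W)$ containing $W$ and closed under binary unions and complements. $c$ is coherent if it extends to a finitely additive probability function (with value $1$ on $W$) on some algebra over $W$ containing $\mathcal{F}$, and incoherent otherwise. $c$ is countably coherent if it extends to a countably additive probability function on some $\sigma$-algebra over $W$ containing $\mathcal{F}$. For $w\in W$, $v_w:\mathcal{F}\to\{0,1\}$ is given by $v_w(p)=1$ iff $w\in p$. A bounded one-dimensional Bregman divergence is a bounded function $\mathfrak{d}:[0,1]^2\to[0,\infty)$ of the form $\mathfrak{d}(x,y)=\varphi(x)-\varphi(y)-\varphi'(y)(x-y)$, where $\varphi:[0,1]\to\mathbb{R}$ is continuous and strictly convex on $[0,1]$, continuously differentiable on $(0,1)$, and $\varphi'(i):=\lim_{x\to i}\varphi'(x)$ for $i\in\{0,1\}$ (boundedness of $\mathfrak{d}$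 is equivalent to these limits being finite). For countably infinite $\mathcal{F}=\{p_1,p_2,\ldots\}$ (enumerated without repetition), a generalized legitimate inaccuracy measure is a map $\mathscr{I}(c,w)=\sum_{i=1}^\infty a_i\,\mathfrak{d}(v_w(p_i),c(p_i))\in[0,\infty]$ ($c$ a credence function, $w\in W$), with $\mathfrak{d}$ a bounded one-dimensional Bregman divergence and $a_i\in(0,\infty)$, $\sup_i a_i<\infty$. A credence function $d$ weakly dominates $c$ relative to $\mathscr{I}$ if $\mathscr{I}(c,w)\ge\mathscr{I}(d,w)$ for all $w\in W$, with strict inequality for some $w\in W$. Compactification. Fix an enumeration $p_1,p_2,\ldots$ of $\mathcal{F}$. For $f:\mathbb{N}\to\{0,1\}$ (indices $n\ge1$) put $p_n^{f(n)}=p_n$ if $f(n)=0$ and $p_n^{f(n)}=W\setminus p_n$ if $f(n)=1$. Let $S$ be the set of sequences $s=\{p_n^{f(n)}\}_{n=1}^\infty$ (determined by $f$) such that $\bigcap_{n=1}^N p_n^{f(n)}\ne\varnothing$ for every $N$ but $\bigcap_{n=1}^\infty p_n^{f(n)}=\varnothing$. Let $W^*=W\cup\{x_s:s\in S\}$, where the $x_s$ are distinct new points. For $p=p_n\in\mathcal{F}$ let $\Psi(p)=p^*=p\cup\{x_s: s\in S,\ f(n)=0\text{ for the }f\text{ determining }s\}$, and let $\mathcal{F}^*=\{p^*:p\in\mathcal{F}\}$. $(W^*,\mathcal{F}^* )$ is the compactification of $(W,\mathcal{F})$ and $\Psi:\mathcal{F}\to\mathcal{F}^*$ is a bijection. For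 a coherent credence function $c$ on $\mathcal{F}$, $c^*$ is the credence function on $\mathcal{F}^*$ given by $c^*(\Psi(p))=c(p)$; it is known to be countably coherent. The measure $\mathscr{I}$ is also used on $(W^*,\mathcal{F}^* )$, with the same $\mathfrak{d}$ and weights: $\mathscr{I}(e,w)=\sum_i a_i\,\mathfrak{d}(v_w(p_i^* ),e(p_i^* ))$ for $e:\mathcal{F}^*\to[0,1]$, $w\in W^*$, where $v_w(p^* )=1$ iff $w\in p^*$. W-stability. $(W,\mathcal{F})$ is W-stable relative to $\mathscr{I}$ if for every coherent credence function $c$ on $\mathcal{F}$: if $c$ is weakly dominated relative to $\mathscr{I}$, then $c^*$ on $(W^*,\mathcal{F}^* )$ is weakly dominated relative to $\mathscr{I}$. Finite expected inaccuracy. A countably coherent $c$ has finite expected inaccuracy relative to $\mathscr{I}$ if $c$ has an extension to a countably additive probability $\bar c$ on $\sigma(\mathcal{F})$ (the $\sigma$-algebra over the underlying set of worlds generated by $\mathcal{F}$) with $\mathbb{E}_{\bar c}\,\mathscr{I}(c,\cdot)<\infty$. A coherent but not countably coherent $c$ has finite expected inaccuracy relative to $\mathscr{I}$ if $c^*$ does (on $(W^*,\mathcal{F}^* )$). *)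

theory Defs
  imports "HOL-Probability.Probability"
begin

definition opinion_space :: "'a set \<Rightarrow> 'a set set \<Rightarrow> bool" where
  "opinion_space W F \<longleftrightarrow> W \<noteq> {} \<and> F \<subseteq> Pow W"

text \<open>
  Credence functions are total functions on sets of worlds; every notion below depends only on
  their values on \<open>F\<close>.
\<close>

definition credence :: "'a set set \<Rightarrow> ('a set \<Rightarrow> real) \<Rightarrow> bool" where
  "credence F c \<longleftrightarrow> c \<in> F \<rightarrow> {0..1}"

definition coherent :: "'a set \<Rightarrow> 'a set set \<Rightarrow> ('a set \<Rightarrow> real) \<Rightarrow> bool" where
  "coherent W F c \<longleftrightarrow>
     (\<exists>\<A> \<mu>. algebra W \<A> \<and> F \<subseteq> \<A> \<and>
        \<mu> \<in> \<A> \<rightarrow> {0..1} \<and> \<mu> W = 1 \<and>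
        (\<forall>A\<in>\<A>. \<forall>B\<in>\<A>. A \<inter> B = {} \<longrightarrow> \<mu> (A \<union> B) = \<mu> A + \<mu> B) \<and>
        (\<forall>A\<in>F. \<mu> A = c A))"

definition countably_coherent :: "'a set \<Rightarrow> 'a set set \<Rightarrow> ('a set \<Rightarrow> real) \<Rightarrow> bool" where
  "countably_coherent W F c \<longleftrightarrow>
     (\<exists>M. prob_space M \<and> space M = W \<and> F \<subseteq> sets M \<and> (\<forall>A\<in>F. measure M A = c A))"

definition strictly_convex_on :: "real set \<Rightarrow> (real \<Rightarrow> real) \<Rightarrow> bool" where
  "strictly_convex_on S \<phi> \<longleftrightarrow>
     (\<forall>x\<in>S. \<forall>y\<in>S. \<forall>t. x \<noteq> y \<and> 0 < t \<and> t < 1 \<longrightarrow>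
        \<phi> ((1 - t) * x + t * y) < (1 - t) * \<phi> x + t * \<phi> y)"

text \<open>
  \<open>\<phi>'\<close> is the derivative of \<open>\<phi>\<close> on the open interval, extended to 0 and 1 by its one-sided limits.
  These limits are taken to be real numbers, as finiteness of the divergence requires.
\<close>

definition bounded_bregman_divergence :: "(real \<Rightarrow> real \<Rightarrow> real) \<Rightarrow> bool" where
  "bounded_bregman_divergence \<dd> \<longleftrightarrow>
     (\<forall>x\<in>{0..1}. \<forall>y\<in>{0..1}. 0 \<le> \<dd> x y) \<and>
     bounded ((\<lambda>(x, y). \<dd> x y) ` ({0..1} \<times> {0..1})) \<and>
     (\<exists>\<phi> \<phi>'. continuous_on {0..1} \<phi> \<and> strictly_convex_on {0..1} \<phi> \<and>
        (\<forall>x\<in>{0<..<1}. (\<phi> has_real_derivative \<phi>' x) (at x)) \<and>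
        continuous_on {0<..<1} \<phi>' \<and>
        (\<phi>' \<longlongrightarrow> \<phi>' 0) (at_right 0) \<and> (\<phi>' \<longlongrightarrow> \<phi>' 1) (at_left 1) \<and>
        (\<forall>x\<in>{0..1}. \<forall>y\<in>{0..1}. \<dd> x y = \<phi> x - \<phi> y - \<phi>' y * (x - y)))"

text \<open>
  From here on, \<open>p :: nat \<Rightarrow> 'a set\<close> is an enumeration without repetition of the propositions,
  with indices starting at 0, and \<open>a\<close> is the sequence of weights.
\<close>

definition inaccuracy ::
    "(nat \<Rightarrow> 'a set) \<Rightarrow> (nat \<Rightarrow> real) \<Rightarrow> (real \<Rightarrow> real \<Rightarrow> real) \<Rightarrow> ('a set \<Rightarrow> real) \<Rightarrow> 'a \<Rightarrow> ennreal" where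
  "inaccuracy p a \<dd> c w = (\<Sum>i. ennreal (a i * \<dd> (indicat_real (p i) w) (c (p i))))"

definition weakly_dominates ::
    "'a set \<Rightarrow> (('a set \<Rightarrow> real) \<Rightarrow> 'a \<Rightarrow> ennreal) \<Rightarrow> ('a set \<Rightarrow> real) \<Rightarrow> ('a set \<Rightarrow> real) \<Rightarrow> bool" where
  "weakly_dominates W \<I> d c \<longleftrightarrow>
     (\<forall>w\<in>W. \<I> c w \<ge> \<I> d w) \<and> (\<exists>w\<in>W. \<I> c w > \<I> d w)"

definition weakly_dominated ::
    "'a set \<Rightarrow> 'a set set \<Rightarrow> (('a set \<Rightarrow> real) \<Rightarrow> 'a \<Rightarrow> ennreal) \<Rightarrow> ('a set \<Rightarrow> real) \<Rightarrow> bool" where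
  "weakly_dominated W F \<I> c \<longleftrightarrow> (\<exists>d. credence F d \<and> weakly_dominates W \<I> d c)"

definition signed_prop :: "'a set \<Rightarrow> (nat \<Rightarrow> 'a set) \<Rightarrow> (nat \<Rightarrow> bool) \<Rightarrow> nat \<Rightarrow> 'a set" where
  "signed_prop W p f n = (if f n then W - p n else p n)"

text \<open>
  The sequence \<open>signed_prop W p f\<close> determines \<open>f\<close> when \<open>W\<close> is nonempty, so the functions \<open>f\<close>
  serve as the index set of the new points; the point \<open>x\<^sub>s\<close> is \<open>Inr f\<close>, an old world \<open>w\<close> is \<open>Inl w\<close>.
\<close>

definition new_points :: "'a set \<Rightarrow> (nat \<Rightarrow> 'a set) \<Rightarrow> (nat \<Rightarrow> bool) set" where
  "new_points W p =
     {f. (\<forall>N. (\<Inter>n\<le>N. signed_prop W p f n) \<noteq> {}) \<and> (\<Inter>n. signed_prop W p f n) = {}}"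

definition star_worlds :: "'a set \<Rightarrow> (nat \<Rightarrow> 'a set) \<Rightarrow> ('a + (nat \<Rightarrow> bool)) set" where
  "star_worlds W p = Inl ` W \<union> Inr ` new_points W p"

definition star_prop ::
    "'a set \<Rightarrow> (nat \<Rightarrow> 'a set) \<Rightarrow> 'a set \<Rightarrow> ('a + (nat \<Rightarrow> bool)) set" where
  "star_prop W p A =
     Inl ` A \<union> Inr ` {f \<in> new_points W p. \<exists>n. p n = A \<and> \<not> f n}"

definition star_enum ::
    "'a set \<Rightarrow> (nat \<Rightarrow> 'a set) \<Rightarrow> nat \<Rightarrow> ('a + (nat \<Rightarrow> bool)) set" where
  "star_enum W p n = star_prop W p (p n)"

definition star_credence ::
    "'a set \<Rightarrow> (nat \<Rightarrow> 'a set) \<Rightarrow> ('a set \<Rightarrow> real) \<Rightarrow> ('a + (nat \<Rightarrow> bool)) set \<Rightarrow> real" where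
  "star_credence W p c B = c (the_inv_into (range p) (star_prop W p) B)"

definition W_stable ::
    "'a set \<Rightarrow> (nat \<Rightarrow> 'a set) \<Rightarrow> (nat \<Rightarrow> real) \<Rightarrow> (real \<Rightarrow> real \<Rightarrow> real) \<Rightarrow> bool" where
  "W_stable W p a \<dd> \<longleftrightarrow>
     (\<forall>c. credence (range p) c \<and> coherent W (range p) c \<and>
          weakly_dominated W (range p) (inaccuracy p a \<dd>) c \<longrightarrow>
        weakly_dominated (star_worlds W p) (range (star_enum W p))
          (inaccuracy (star_enum W p) a \<dd>) (star_credence W p c))"

definition finite_expected_inaccuracy_cc ::
    "'a set \<Rightarrow> (nat \<Rightarrow> 'a set) \<Rightarrow> (nat \<Rightarrow> real) \<Rightarrow> (real \<Rightarrow> real \<Rightarrow> real) \<Rightarrow> ('a set \<Rightarrow> real) \<Rightarrow> bool" where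
  "finite_expected_inaccuracy_cc W p a \<dd> c \<longleftrightarrow>
     (\<exists>M. prob_space M \<and> space M = W \<and> sets M = sigma_sets W (range p) \<and>
        (\<forall>A\<in>range p. measure M A = c A) \<and>
        (\<integral>\<^sup>+ w. inaccuracy p a \<dd> c w \<partial>M) < \<infinity>)"

definition finite_expected_inaccuracy ::
    "'a set \<Rightarrow> (nat \<Rightarrow> 'a set) \<Rightarrow> (nat \<Rightarrow> real) \<Rightarrow> (real \<Rightarrow> real \<Rightarrow> real) \<Rightarrow> ('a set \<Rightarrow> real) \<Rightarrow> bool" where
  "finite_expected_inaccuracy W p a \<dd> c \<longleftrightarrow>
     (if countably_coherent W (range p) c then finite_expected_inaccuracy_cc W p a \<dd> c
      else finite_expected_inaccuracy_cc (star_worlds W p) (star_enum W p) a \<dd> (star_credence W p c))"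

end

theory Submission
  imports Defs
begin

text \<open>
  A credence function with finite expected inaccuracy under a countably additive extension is
  undominated because a Bregman divergence is strictly proper: changing \<open>c\<close> to \<open>d\<close> raises the
  expected inaccuracy by \<open>\<Sum>i. a\<^sub>i \<dd> (c p\<^sub>i) (d p\<^sub>i)\<close>. If \<open>c\<close> is coherent but not countably coherent,
  this is applied to \<open>c\<^sup>*\<close>, and stability transfers the result to \<open>c\<close>.

  Conversely, the finitely additive probabilities on the power set of \<open>W\<close> form a compact convex set
  in the product topology. If \<open>c\<close> is incoherent, compactness makes it incoherent on finitely many
  propositions; replacing \<open>c\<close> there by its Bregman projection onto this convex set strictly lowers
  the inaccuracy at every world, by the generalized Pythagorean inequality, unless it is infinite.
  If it is infinite at every world, \<open>c\<close> is dominated by the truth values of any single world.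
\<close>

section \<open>Bregman divergences\<close>

text \<open>Combined with \<open>eq\<close>, the assumption \<open>nonneg\<close> is the
  supporting-line inequality: the line of slope \<open>\<phi>' y\<close> through the graph of
  \<open>\<phi>\<close> at \<open>y\<close> never rises above the graph. The one-sided limits at 0
  and 1 enter as continuity of \<open>\<phi>'\<close> on the closed interval.\<close>

locale bregman =
  fixes \<dd> :: "real \<Rightarrow> real \<Rightarrow> real" and \<phi> \<phi>' :: "real \<Rightarrow> real"
  assumes nonneg: "\<And>x y. x \<in> {0..1} \<Longrightarrow> y \<in> {0..1} \<Longrightarrow> 0 \<le> \<dd> x y"
    and cont_phi: "continuous_on {0..1} \<phi>"
    and cont_phi': "continuous_on {0..1} \<phi>'"
    and strict: "strictly_convex_on {0..1} \<phi>"
    and eq: "\<And>x y. x \<in> {0..1} \<Longrightarrow> y \<in> {0..1} \<Longrightarrow> \<dd> x y = \<phi> x - \<phi> y - \<phi>' y * (x - y)"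

lemma bounded_bregman_divergenceE:
  assumes "bounded_bregman_divergence \<dd>"
  obtains \<phi> \<phi>' where "bregman \<dd> \<phi> \<phi>'"
proof -
  obtain \<phi> \<phi>' where *: "continuous_on {0..1} \<phi>" "strictly_convex_on {0..1} \<phi>"
      "continuous_on {0<..<1} \<phi>'" "(\<phi>' \<longlongrightarrow> \<phi>' 0) (at_right 0)" "(\<phi>' \<longlongrightarrow> \<phi>' 1) (at_left 1)"
      "\<forall>x\<in>{0..1}. \<forall>y\<in>{0..1}. \<dd> x y = \<phi> x - \<phi> y - \<phi>' y * (x - y)"
      "\<forall>x\<in>{0..1}. \<forall>y\<in>{0..1}. 0 \<le> \<dd> x y"
    using assms unfolding bounded_bregman_divergence_def by auto
  have "continuous_on {0..1} \<phi>'"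
  proof (rule continuous_on_IccI)
    show "\<phi>' \<midarrow>x\<rightarrow> \<phi>' x" if "0 < x" "x < 1" for x
      using *(3) that by (auto simp: continuous_on_eq_continuous_at isCont_def)
  qed (use * in auto)
  with * have "bregman \<dd> \<phi> \<phi>'"
    by unfold_locales auto
  then show thesis by (rule that)
qed

context bregman
begin

lemma self [simp]: "x \<in> {0..1} \<Longrightarrow> \<dd> x x = 0"
  by (simp add: eq)

text \<open>At the midpoint \<open>m\<close>, strict convexity puts \<open>\<phi> m\<close> below
  the chord, while \<open>\<dd> m y \<ge> 0\<close> keeps it on or above the supporting line at
  \<open>y\<close>. Hence at \<open>x\<close> the graph lies strictly above that line.\<close>

lemma pos:
  assumes x: "x \<in> {0..1}" and y: "y \<in> {0..1}" and "x \<noteq> y"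
  shows "0 < \<dd> x y"
proof -
  define m where "m = (1 - 1/2) * x + 1/2 * y"
  have m: "m \<in> {0..1}"
    using x y by (auto simp: m_def)
  have "\<phi> m < (1 - 1/2) * \<phi> x + 1/2 * \<phi> y"
    unfolding m_def
    by (rule strict[unfolded strictly_convex_on_def, rule_format]) (use x y \<open>x \<noteq> y\<close> in auto)
  moreover have "0 \<le> \<dd> m y"
    by (rule nonneg[OF m y])
  ultimately show ?thesis
    unfolding eq[OF m y] eq[OF x y] by (simp add: m_def field_simps)
qed

text \<open>For fixed \<open>y\<close>, \<open>\<dd>\<close> is \<open>\<phi>\<close> plus an affine
  function of its first argument, so averaging over the truth values 1 and 0 evaluates the affine
  part at \<open>m\<close>. Together with \<open>pos\<close> this is strict propriety.\<close>

lemma expectation: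
  assumes "m \<in> {0..1}" "y \<in> {0..1}"
  shows "m * \<dd> 1 y + (1 - m) * \<dd> 0 y = m * \<dd> 1 m + (1 - m) * \<dd> 0 m + \<dd> m y"
  using assms by (simp add: eq algebra_simps)

text \<open>
  The first-order optimality condition for a minimiser \<open>q\<close> is obtained without differentiating
  \<open>\<phi>\<close> at the endpoints, from \<open>\<dd> q\<^sub>i (q\<^sub>i + t (v\<^sub>i - q\<^sub>i)) \<ge> 0\<close> and continuity of \<open>\<phi>'\<close> as \<open>t\<close> tends to 0.
\<close>

lemma pythagorean:
  assumes a: "\<And>i. i \<in> I \<Longrightarrow> 0 \<le> a i"
    and q: "\<And>i. i \<in> I \<Longrightarrow> q i \<in> {0..1}" and v: "\<And>i. i \<in> I \<Longrightarrow> v i \<in> {0..1}"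
    and c: "\<And>i. i \<in> I \<Longrightarrow> c i \<in> {0..1}"
    and min: "\<And>t. 0 < t \<Longrightarrow> t < 1 \<Longrightarrow>
      (\<Sum>i\<in>I. a i * \<dd> (q i) (c i)) \<le> (\<Sum>i\<in>I. a i * \<dd> ((1 - t) * q i + t * v i) (c i))"
  shows "(\<Sum>i\<in>I. a i * \<dd> (v i) (q i)) + (\<Sum>i\<in>I. a i * \<dd> (q i) (c i)) \<le> (\<Sum>i\<in>I. a i * \<dd> (v i) (c i))"
proof -
  define x where "x t i = (1 - t) * q i + t * v i" for t i
  \<comment> \<open>Formally \<open>G t\<close> is the derivative in \<open>t\<close> of the
    weighted divergence from \<open>c\<close> along the segment from \<open>q\<close> to
    \<open>v\<close>.\<close>
  define G where "G t = (\<Sum>i\<in>I. a i * ((\<phi>' (x t i) - \<phi>' (c i)) * (v i - q i)))" for t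
  have x: "x t i \<in> {0..1}" if "t \<in> {0..1}" "i \<in> I" for t i
  proof -
    have "(1 - t) *\<^sub>R q i + t *\<^sub>R v i \<in> {0..1}"
      by (rule convexD[OF convex_real_interval(5)]) (use that q v in auto)
    then show ?thesis by (simp add: x_def)
  qed
  have G_nonneg: "0 \<le> G t" if t: "0 < t" "t < 1" for t
  proof -
    have "0 \<le> (\<Sum>i\<in>I. a i * \<dd> (x t i) (c i)) - (\<Sum>i\<in>I. a i * \<dd> (q i) (c i))"
      using min[OF t] by (simp add: x_def)
    also have "\<dots> = (\<Sum>i\<in>I. a i * (\<dd> (x t i) (c i) - \<dd> (q i) (c i)))"
      by (simp add: sum_subtractf right_diff_distrib)
    also have "\<dots> \<le> (\<Sum>i\<in>I. a i * (t * ((\<phi>' (x t i) - \<phi>' (c i)) * (v i - q i))))"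
    proof (intro sum_mono mult_left_mono a)
      fix i assume i: "i \<in> I"
      have xi: "x t i \<in> {0..1}" using x t i by simp
      have "0 \<le> \<dd> (q i) (x t i)" using nonneg q i xi by blast
      then have "\<dd> (x t i) (c i) - \<dd> (q i) (c i) \<le> (\<phi>' (x t i) - \<phi>' (c i)) * (x t i - q i)"
        unfolding eq[OF xi c[OF i]] eq[OF q[OF i] c[OF i]] eq[OF q[OF i] xi]
        by (simp add: left_diff_distrib right_diff_distrib)
      also have "x t i - q i = t * (v i - q i)"
        by (simp add: x_def left_diff_distrib right_diff_distrib)
      finally show "\<dd> (x t i) (c i) - \<dd> (q i) (c i) \<le> t * ((\<phi>' (x t i) - \<phi>' (c i)) * (v i - q i))"
        by (simp only: mult.left_commute)
    qed
    also have "\<dots> = t * G t"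
      by (simp add: G_def sum_distrib_left mult_ac)
    finally show ?thesis
      using t by (simp add: zero_le_mult_iff)
  qed
  have "continuous_on {0..1} G"
    unfolding G_def
  proof (intro continuous_intros)
    fix i assume "i \<in> I"
    then show "continuous_on {0..1} (\<lambda>t. \<phi>' (x t i))"
      using x by (intro continuous_on_compose2[OF cont_phi'])
        (auto simp: x_def intro!: continuous_intros)
  qed
  then have "(G \<longlongrightarrow> G 0) (at_right 0)"
    by (simp add: continuous_on_Icc_at_rightD)
  moreover have "eventually (\<lambda>t. 0 \<le> G t) (at_right 0)"
    by (rule eventually_at_rightI[of 0 1]) (auto intro: G_nonneg)
  ultimately have "0 \<le> G 0"
    by (intro tendsto_lowerbound[of G]) auto
  \<comment> \<open>Termwise this is the three-point identity for Bregman divergences.\<close>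
  also have "G 0 = (\<Sum>i\<in>I. a i * \<dd> (v i) (c i) - (a i * \<dd> (v i) (q i) + a i * \<dd> (q i) (c i)))"
    unfolding G_def
  proof (intro sum.cong refl)
    fix i assume i: "i \<in> I"
    show "a i * ((\<phi>' (x 0 i) - \<phi>' (c i)) * (v i - q i)) =
        a i * \<dd> (v i) (c i) - (a i * \<dd> (v i) (q i) + a i * \<dd> (q i) (c i))"
      unfolding eq[OF v[OF i] c[OF i]] eq[OF v[OF i] q[OF i]] eq[OF q[OF i] c[OF i]]
      by (simp add: x_def algebra_simps)
  qed
  finally show ?thesis
    by (simp add: sum_subtractf sum.distrib)
qed

end

section \<open>Finitely additive probabilities on a power set\<close>

text \<open>Values on sets outside \<open>W\<close> are confined to the unit interval too, so that
  the charges lie in a cube over all sets, to which Tychonoff's theorem applies.\<close>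

definition charges :: "'a set \<Rightarrow> ('a set \<Rightarrow> real) set" where
  "charges W = {\<mu>. (\<forall>A. \<mu> A \<in> {0..1}) \<and> \<mu> W = 1 \<and>
     (\<forall>A B. A \<union> B \<subseteq> W \<and> A \<inter> B = {} \<longrightarrow> \<mu> (A \<union> B) = \<mu> A + \<mu> B)}"

lemma coherent_if_charge:
  assumes "\<mu> \<in> charges W" "F \<subseteq> Pow W" "\<And>A. A \<in> F \<Longrightarrow> \<mu> A = c A"
  shows "coherent W F c"
  unfolding coherent_def
  by (rule exI[of _ "Pow W"], rule exI[of _ \<mu>])
     (use assms in \<open>auto simp: charges_def algebra_Pow\<close>)

lemma point_mass_in_charges: "w \<in> W \<Longrightarrow> (\<lambda>A. indicat_real A w) \<in> charges W"
  by (auto simp: charges_def indicator_def)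

lemma charges_convex:
  assumes "\<mu> \<in> charges W" "\<nu> \<in> charges W" "0 \<le> t" "t \<le> 1"
  shows "(\<lambda>A. (1 - t) * \<mu> A + t * \<nu> A) \<in> charges W"
proof -
  have "(1 - t) *\<^sub>R \<mu> A + t *\<^sub>R \<nu> A \<in> {0..1}" for A
    by (rule convexD[OF convex_real_interval(5)]) (use assms in \<open>auto simp: charges_def\<close>)
  then show ?thesis
    using assms by (auto simp: charges_def algebra_simps)
qed

text \<open>The cube is compact, and each defining equation involves finitely many coordinates,
  hence is a closed condition in the product topology.\<close>

lemma compact_charges: "compact (charges W)"
proof -
  have "compactin (product_topology (\<lambda>_. euclidean) UNIV) (PiE UNIV (\<lambda>_::'a set. {0..1::real}))"
    by (subst compactin_PiE) auto
  then have "compact (PiE UNIV (\<lambda>_::'a set. {0..1::real}))"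
    by (simp add: euclidean_product_topology)
  moreover have "closed {\<mu>::'a set \<Rightarrow> real. \<mu> W = 1}"
    by (intro closed_Collect_eq continuous_intros continuous_on_product_coordinates)
  moreover have "closed {\<mu>::'a set \<Rightarrow> real. \<forall>A B. A \<union> B \<subseteq> W \<and> A \<inter> B = {} \<longrightarrow> \<mu> (A \<union> B) = \<mu> A + \<mu> B}"
    by (intro closed_Collect_all closed_Collect_imp closed_Collect_eq continuous_intros
        continuous_on_product_coordinates open_Collect_const)
  ultimately have "compact (PiE UNIV (\<lambda>_::'a set. {0..1::real}) \<inter> {\<mu>. \<mu> W = 1} \<inter>
      {\<mu>. \<forall>A B. A \<union> B \<subseteq> W \<and> A \<inter> B = {} \<longrightarrow> \<mu> (A \<union> B) = \<mu> A + \<mu> B})"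
    by (intro compact_Int_closed)
  also have "\<dots> = charges W"
    by (auto simp: charges_def PiE_def)
  finally show ?thesis .
qed

text \<open>The charges matching \<open>c\<close> at one proposition form a closed set; the finite
  intersection property yields a single charge matching it at all of them.\<close>

lemma coherent_if_finitely_coherent:
  fixes p :: "nat \<Rightarrow> 'a set"
  assumes F: "range p \<subseteq> Pow W"
    and fin: "\<And>N. \<exists>\<mu>\<in>charges W. \<forall>i<N. \<mu> (p i) = c (p i)"
  shows "coherent W (range p) c"
proof -
  have "charges W \<inter> (\<Inter>i\<in>(UNIV::nat set). {\<mu>. \<mu> (p i) = c (p i)}) \<noteq> {}"
  proof (rule compact_imp_fip_image[OF compact_charges])
    show "closed {\<mu>. \<mu> (p i) = c (p i)}" for i
      by (intro closed_Collect_eq continuous_intros continuous_on_product_coordinates)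
    fix J :: "nat set" assume "finite J"
    then obtain N where "J \<subseteq> {..<N}"
      using finite_nat_iff_bounded by blast
    then show "charges W \<inter> (\<Inter>i\<in>J. {\<mu>. \<mu> (p i) = c (p i)}) \<noteq> {}"
      using fin[of N] by blast
  qed
  then show ?thesis
    using F by (auto intro: coherent_if_charge)
qed

section \<open>Incoherence implies dominance\<close>

text \<open>The minimal divergence \<open>D \<mu>\<close> is positive since no charge matches
  \<open>c\<close> on the first \<open>N\<close> propositions. By the Pythagorean inequality it
  bounds the gain at every world from below.\<close>

lemma (in bregman) projection_dominates:
  assumes "W \<noteq> {}" and a: "\<And>i. 0 < a i" and c: "\<And>i. c (p i) \<in> {0..1}"
    and inc: "\<And>\<mu>. \<mu> \<in> charges W \<Longrightarrow> \<exists>i<N::nat. \<mu> (p i) \<noteq> c (p i)"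
  obtains \<mu> where "\<mu> \<in> charges W"
    "\<And>w. w \<in> W \<Longrightarrow> (\<Sum>i<N. a i * \<dd> (indicat_real (p i) w) (\<mu> (p i))) <
       (\<Sum>i<N. a i * \<dd> (indicat_real (p i) w) (c (p i)))"
proof -
  define D where "D \<mu> = (\<Sum>i<N. a i * \<dd> (\<mu> (p i)) (c (p i)))" for \<mu> :: "'a set \<Rightarrow> real"
  have "continuous_on (charges W) (\<lambda>\<mu>. \<dd> (\<mu> (p i)) (c (p i)))" for i
  proof -
    have coord: "continuous_on (charges W) (\<lambda>\<mu>. \<mu> (p i))"
      by (rule continuous_on_subset[OF continuous_on_product_coordinates]) simp
    have "continuous_on (charges W)
        (\<lambda>\<mu>. \<phi> (\<mu> (p i)) - \<phi> (c (p i)) - \<phi>' (c (p i)) * (\<mu> (p i) - c (p i)))"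
      by (intro continuous_intros continuous_on_compose2[OF cont_phi coord] coord)
         (auto simp: charges_def)
    then show ?thesis
      by (rule continuous_on_eq) (use c in \<open>auto simp: eq charges_def\<close>)
  qed
  then have "continuous_on (charges W) D"
    unfolding D_def by (intro continuous_intros)
  moreover have "charges W \<noteq> {}"
    using \<open>W \<noteq> {}\<close> point_mass_in_charges by fastforce
  ultimately obtain \<mu> where \<mu>: "\<mu> \<in> charges W" and min: "\<And>\<nu>. \<nu> \<in> charges W \<Longrightarrow> D \<mu> \<le> D \<nu>"
    using continuous_attains_inf[OF compact_charges] by metis
  have \<mu>01: "\<mu> A \<in> {0..1}" for A
    using \<mu> by (auto simp: charges_def)
  obtain j where j: "j < N" "\<mu> (p j) \<noteq> c (p j)"
    using inc[OF \<mu>] by auto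
  have "0 < D \<mu>"
    unfolding D_def
  proof (rule sum_pos2[of _ j])
    show "0 < a j * \<dd> (\<mu> (p j)) (c (p j))"
      using a pos \<mu>01 c j by simp
    show "0 \<le> a i * \<dd> (\<mu> (p i)) (c (p i))" for i
      using less_imp_le[OF a] nonneg \<mu>01 c by simp
  qed (use j in auto)
  moreover have "(\<Sum>i<N. a i * \<dd> (indicat_real (p i) w) (\<mu> (p i))) + D \<mu>
      \<le> (\<Sum>i<N. a i * \<dd> (indicat_real (p i) w) (c (p i)))" if "w \<in> W" for w
    unfolding D_def
  proof (rule pythagorean)
    fix t :: real assume "0 < t" "t < 1"
    \<comment> \<open>The truth values at \<open>w\<close> are themselves a charge, so the segment
      from \<open>\<mu>\<close> towards them stays among the competitors of the minimiser.\<close>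
    then have "(\<lambda>A. (1 - t) * \<mu> A + t * indicat_real A w) \<in> charges W"
      using \<mu> point_mass_in_charges[OF \<open>w \<in> W\<close>] by (intro charges_convex) auto
    from min[OF this]
    show "(\<Sum>i<N. a i * \<dd> (\<mu> (p i)) (c (p i)))
        \<le> (\<Sum>i<N. a i * \<dd> ((1 - t) * \<mu> (p i) + t * indicat_real (p i) w) (c (p i)))"
      by (simp add: D_def)
  qed (use a \<mu>01 c in \<open>auto simp: less_imp_le indicator_def\<close>)
  ultimately show thesis
    using \<mu> by (intro that[of \<mu>]) fastforce+
qed

lemma (in bregman) weakly_dominated_if_incoherent:
  assumes "W \<noteq> {}" and F: "range p \<subseteq> Pow W" and "inj p"
    and a: "\<And>i. 0 < a i" and c: "credence (range p) c"
    and "\<not> coherent W (range p) c"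
  shows "weakly_dominated W (range p) (inaccuracy p a \<dd>) c"
proof (cases "\<forall>w\<in>W. inaccuracy p a \<dd> c w = \<infinity>")
  case True
  obtain w where w: "w \<in> W"
    using \<open>W \<noteq> {}\<close> by auto
  have "inaccuracy p a \<dd> (\<lambda>A. indicat_real A w) w = 0"
    by (simp add: inaccuracy_def indicator_def)
  with True w have "weakly_dominates W (inaccuracy p a \<dd>) (\<lambda>A. indicat_real A w) c"
    unfolding weakly_dominates_def by force
  moreover have "credence (range p) (\<lambda>A. indicat_real A w)"
    by (auto simp: credence_def indicator_def)
  ultimately show ?thesis
    unfolding weakly_dominated_def by (intro exI[of _ "\<lambda>A. indicat_real A w"] conjI)
next
  case False
  have c01: "c (p i) \<in> {0..1}" for i
    using c by (auto simp: credence_def)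
  obtain N where N: "\<And>\<mu>. \<mu> \<in> charges W \<Longrightarrow> \<exists>i<N. \<mu> (p i) \<noteq> c (p i)"
    using coherent_if_finitely_coherent[OF F, where c = c] assms(6) by blast
  obtain \<mu> where \<mu>: "\<mu> \<in> charges W"
    and less: "\<And>w. w \<in> W \<Longrightarrow> (\<Sum>i<N. a i * \<dd> (indicat_real (p i) w) (\<mu> (p i))) <
       (\<Sum>i<N. a i * \<dd> (indicat_real (p i) w) (c (p i)))"
    by (rule projection_dominates[where a = a and p = p and N = N, OF \<open>W \<noteq> {}\<close> a c01 N]) blast+
  \<comment> \<open>Only the first \<open>N\<close> propositions are changed, so \<open>c\<close>
    and \<open>d\<close> share the same tail of the series and the comparison reduces to finite
    sums.\<close>
  define d where "d A = (if A \<in> p ` {..<N} then \<mu> A else c A)" for A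
  have \<mu>01: "\<mu> A \<in> {0..1}" for A
    using \<mu> by (auto simp: charges_def)
  have d: "credence (range p) d"
    using \<mu>01 c by (auto simp: d_def credence_def)
  have d_less: "d (p i) = \<mu> (p i)" if "i < N" for i
    using that by (simp add: d_def)
  have d_ge: "d (p (i + N)) = c (p (i + N))" for i
    using \<open>inj p\<close> by (auto simp: d_def inj_eq)
  have split: "inaccuracy p a \<dd> e w =
      (\<Sum>i. ennreal (a (i + N) * \<dd> (indicat_real (p (i + N)) w) (e (p (i + N)))))
      + ennreal (\<Sum>i<N. a i * \<dd> (indicat_real (p i) w) (e (p i)))"
    if "credence (range p) e" for e w
  proof -
    have "0 \<le> a i * \<dd> (indicat_real (p i) w) (e (p i))" for i
      using that by (intro mult_nonneg_nonneg nonneg less_imp_le[OF a])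
        (auto simp: credence_def indicator_def)
    then show ?thesis
      unfolding inaccuracy_def by (subst suminf_offset[where i = N]) auto
  qed
  have I_d: "inaccuracy p a \<dd> d w =
      (\<Sum>i. ennreal (a (i + N) * \<dd> (indicat_real (p (i + N)) w) (c (p (i + N)))))
      + ennreal (\<Sum>i<N. a i * \<dd> (indicat_real (p i) w) (\<mu> (p i)))" for w
    unfolding split[OF d] by (simp add: d_less d_ge)
  have nn: "0 \<le> (\<Sum>i<N. a i * \<dd> (indicat_real (p i) w) (\<mu> (p i)))" for w
    using \<mu>01 by (intro sum_nonneg mult_nonneg_nonneg nonneg less_imp_le[OF a])
      (auto simp: indicator_def)
  obtain w where w: "w \<in> W" "inaccuracy p a \<dd> c w \<noteq> \<infinity>"
    using False by blast
  \<comment> \<open>Cancelling the common tail requires it to be finite, which the choice of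
    \<open>w\<close> guarantees. At other worlds it may be infinite, and the weak inequality is
    derived there.\<close>
  have "inaccuracy p a \<dd> d w < inaccuracy p a \<dd> c w"
    using w(2) ennreal_lessI[OF le_less_trans[OF nn less[OF w(1)]] less[OF w(1)]]
    unfolding I_d split[OF c] by (simp add: ennreal_add_left_cancel_less)
  moreover have "inaccuracy p a \<dd> d u \<le> inaccuracy p a \<dd> c u" if "u \<in> W" for u
    using less[OF that] unfolding I_d split[OF c] by (intro add_left_mono ennreal_leI) simp
  ultimately show ?thesis
    using d w(1) unfolding weakly_dominated_def weakly_dominates_def by blast
qed

section \<open>Finite expected inaccuracy excludes dominance\<close>

lemma (in bregman) nn_integral_score:
  assumes "prob_space M" and A: "A \<in> sets M" and b: "0 \<le> b" and y: "y \<in> {0..1}"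
  shows "(\<integral>\<^sup>+ w. ennreal (b * \<dd> (indicat_real A w) y) \<partial>M) =
    ennreal (b * (measure M A * \<dd> 1 y + (1 - measure M A) * \<dd> 0 y))"
proof -
  interpret prob_space M by fact
  have nn: "0 \<le> \<dd> 1 y" "0 \<le> \<dd> 0 y"
    using nonneg y by auto
  have "(\<integral>\<^sup>+ w. ennreal (b * \<dd> (indicat_real A w) y) \<partial>M) =
      (\<integral>\<^sup>+ w. ennreal (b * \<dd> 1 y) * indicator A w + ennreal (b * \<dd> 0 y) * indicator (space M - A) w \<partial>M)"
    by (rule nn_integral_cong) (auto simp: indicator_def)
  also have "\<dots> = ennreal (b * \<dd> 1 y) * emeasure M A + ennreal (b * \<dd> 0 y) * emeasure M (space M - A)"
    using A by (subst nn_integral_add) (auto simp: nn_integral_cmult_indicator)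
  also have "\<dots> = ennreal (b * \<dd> 1 y * prob A + b * \<dd> 0 y * (1 - prob A))"
    using b nn by (subst ennreal_plus) (auto simp: emeasure_eq_measure prob_compl[OF A] ennreal_mult)
  also have "b * \<dd> 1 y * prob A + b * \<dd> 0 y * (1 - prob A) = b * (prob A * \<dd> 1 y + (1 - prob A) * \<dd> 0 y)"
    by (simp add: algebra_simps)
  finally show ?thesis .
qed

text \<open>All terms are nonnegative, so integral and series commute and \<open>expectation\<close>
  applies to each proposition. The gap is added rather than subtracted because both expectations may
  be infinite.\<close>

lemma (in bregman) expected_inaccuracy:
  assumes "prob_space M" and p: "\<And>i. p i \<in> sets M" and a: "\<And>i. 0 < a i"
    and d: "credence (range p) d"
  shows "(\<integral>\<^sup>+ w. inaccuracy p a \<dd> d w \<partial>M) =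
    (\<integral>\<^sup>+ w. inaccuracy p a \<dd> (measure M) w \<partial>M) + (\<Sum>i. ennreal (a i * \<dd> (measure M (p i)) (d (p i))))"
proof -
  interpret prob_space M by fact
  have m01: "prob (p i) \<in> {0..1}" for i
    by simp
  have int: "(\<integral>\<^sup>+ w. inaccuracy p a \<dd> e w \<partial>M) =
      (\<Sum>i. ennreal (a i * (prob (p i) * \<dd> 1 (e (p i)) + (1 - prob (p i)) * \<dd> 0 (e (p i)))))"
    if "credence (range p) e" for e
  proof -
    have [measurable]: "(\<lambda>w. ennreal (a i * \<dd> (indicat_real (p i) w) (e (p i)))) \<in> borel_measurable M" for i
    proof -
      \<comment> \<open>Writing the score as an affine function of the indicator makes its
        measurability evident.\<close>
      have "\<dd> (indicat_real (p i) w) (e (p i)) =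
          indicat_real (p i) w * \<dd> 1 (e (p i)) + (1 - indicat_real (p i) w) * \<dd> 0 (e (p i))" for w
        by (simp add: indicator_def)
      then show ?thesis
        using p by simp
    qed
    have "e (p i) \<in> {0..1}" for i
      using that by (auto simp: credence_def)
    then show ?thesis
      unfolding inaccuracy_def
      by (subst nn_integral_suminf)
         (simp_all add: nn_integral_score[OF \<open>prob_space M\<close> p less_imp_le[OF a]])
  qed
  have score: "ennreal (a i * (prob (p i) * \<dd> 1 (d (p i)) + (1 - prob (p i)) * \<dd> 0 (d (p i)))) =
      ennreal (a i * (prob (p i) * \<dd> 1 (prob (p i)) + (1 - prob (p i)) * \<dd> 0 (prob (p i))))
      + ennreal (a i * \<dd> (prob (p i)) (d (p i)))" for i
  proof -
    have d01: "d (p i) \<in> {0..1}"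
      using d by (auto simp: credence_def)
    have "0 \<le> a i * (prob (p i) * \<dd> 1 (prob (p i)) + (1 - prob (p i)) * \<dd> 0 (prob (p i)))"
      using m01 by (intro mult_nonneg_nonneg add_nonneg_nonneg nonneg less_imp_le[OF a]) auto
    moreover have "0 \<le> a i * \<dd> (prob (p i)) (d (p i))"
      using m01 d01 by (intro mult_nonneg_nonneg nonneg less_imp_le[OF a]) auto
    ultimately show ?thesis
      by (simp only: expectation[OF m01[of i] d01] distrib_left[of "a i" _ "\<dd> (prob (p i)) (d (p i))"]
          ennreal_plus)
  qed
  have prob: "credence (range p) prob"
    by (simp add: credence_def)
  show ?thesis
    by (simp only: int[OF d] int[OF prob] score suminf_add[OF summableI summableI])
qed

lemma (in bregman) not_weakly_dominated:
  assumes fin: "finite_expected_inaccuracy_cc W p a \<dd> c" and a: "\<And>i. 0 < a i"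
  shows "\<not> weakly_dominated W (range p) (inaccuracy p a \<dd>) c"
proof
  assume "weakly_dominated W (range p) (inaccuracy p a \<dd>) c"
  then obtain d where d: "credence (range p) d"
    and le: "\<And>w. w \<in> W \<Longrightarrow> inaccuracy p a \<dd> d w \<le> inaccuracy p a \<dd> c w"
    and less: "\<exists>w\<in>W. inaccuracy p a \<dd> d w < inaccuracy p a \<dd> c w"
    unfolding weakly_dominated_def weakly_dominates_def by blast
  obtain M where M: "prob_space M" "space M = W" "sets M = sigma_sets W (range p)"
    and Mc: "\<And>A. A \<in> range p \<Longrightarrow> measure M A = c A"
    and lt: "(\<integral>\<^sup>+ w. inaccuracy p a \<dd> c w \<partial>M) < \<infinity>"
    using fin unfolding finite_expected_inaccuracy_cc_def by blast
  interpret prob_space M by fact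
  have p: "p i \<in> sets M" for i
    using M(3) by auto
  have c_eq: "inaccuracy p a \<dd> (measure M) = inaccuracy p a \<dd> c"
    by (simp add: inaccuracy_def Mc fun_eq_iff)
  have "(\<integral>\<^sup>+ w. inaccuracy p a \<dd> d w \<partial>M) \<le> (\<integral>\<^sup>+ w. inaccuracy p a \<dd> c w \<partial>M)"
    by (rule nn_integral_mono) (simp add: le M(2))
  then have "(\<integral>\<^sup>+ w. inaccuracy p a \<dd> c w \<partial>M) + (\<Sum>i. ennreal (a i * \<dd> (prob (p i)) (d (p i))))
      \<le> (\<integral>\<^sup>+ w. inaccuracy p a \<dd> c w \<partial>M)"
    using expected_inaccuracy[OF M(1) p a d] by (simp only: c_eq)
  moreover have "(\<integral>\<^sup>+ w. inaccuracy p a \<dd> c w \<partial>M) \<noteq> \<infinity>"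
    using lt by (rule less_imp_neq)
  \<comment> \<open>Finite expectation permits cancellation in \<open>ennreal\<close>. Each
    divergence then vanishes, so \<open>d\<close> agrees with \<open>c\<close> on every proposition
    and no strict improvement remains.\<close>
  ultimately have "(\<Sum>i. ennreal (a i * \<dd> (prob (p i)) (d (p i)))) \<le> 0"
    using ennreal_add_left_cancel_le[where c = 0] by fastforce
  then have zero: "ennreal (a i * \<dd> (prob (p i)) (d (p i))) = 0" for i
    by (simp add: suminf_eq_zero_iff)
  have "prob (p i) = d (p i)" for i
  proof (rule ccontr)
    assume "prob (p i) \<noteq> d (p i)"
    moreover have "d (p i) \<in> {0..1}"
      using d by (auto simp: credence_def)
    ultimately have "0 < \<dd> (prob (p i)) (d (p i))"
      by (intro pos) auto
    with a[of i] have "0 < a i * \<dd> (prob (p i)) (d (p i))"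
      by (rule mult_pos_pos)
    with zero[of i] show False
      by (simp add: ennreal_eq_0_iff)
  qed
  then have "d (p i) = c (p i)" for i
    using Mc[of "p i"] by simp
  then have "inaccuracy p a \<dd> d = inaccuracy p a \<dd> c"
    by (simp add: inaccuracy_def fun_eq_iff)
  with less show False by simp
qed

theorem theorem4p19:
  fixes W :: "'a set" and F :: "'a set set" and p :: "nat \<Rightarrow> 'a set"
    and a :: "nat \<Rightarrow> real" and \<dd> :: "real \<Rightarrow> real \<Rightarrow> real"
  assumes "opinion_space W F"
    and "bij_betw p UNIV F"
    and "bounded_bregman_divergence \<dd>"
    and "\<And>i. 0 < a i" and "bdd_above (range a)"
    and "W_stable W p a \<dd>"
    and "\<And>c. credence F c \<Longrightarrow> coherent W F c \<Longrightarrow> finite_expected_inaccuracy W p a \<dd> c"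
  shows "\<forall>c. credence F c \<longrightarrow>
    (coherent W F c \<longleftrightarrow> \<not> weakly_dominated W F (inaccuracy p a \<dd>) c)"
proof (intro allI impI)
  fix c assume c: "credence F c"
  have F: "F = range p" and "inj p"
    using assms(2) by (auto simp: bij_betw_def)
  have W: "W \<noteq> {}" "range p \<subseteq> Pow W"
    using assms(1) by (auto simp: opinion_space_def F)
  obtain \<phi> \<phi>' where "bregman \<dd> \<phi> \<phi>'"
    using assms(3) by (rule bounded_bregman_divergenceE)
  then interpret bregman \<dd> \<phi> \<phi>' .
  show "coherent W F c \<longleftrightarrow> \<not> weakly_dominated W F (inaccuracy p a \<dd>) c"
  proof
    assume coh: "coherent W F c"
    have fin: "finite_expected_inaccuracy W p a \<dd> c"
      using assms(7)[OF c coh] .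
    show "\<not> weakly_dominated W F (inaccuracy p a \<dd>) c"
    proof (cases "countably_coherent W (range p) c")
      case True
      with fin have "finite_expected_inaccuracy_cc W p a \<dd> c"
        by (simp add: finite_expected_inaccuracy_def)
      then show ?thesis
        unfolding F by (rule not_weakly_dominated) (rule assms(4))
    next
      case False
      with fin have "finite_expected_inaccuracy_cc (star_worlds W p) (star_enum W p) a \<dd> (star_credence W p c)"
        by (simp add: finite_expected_inaccuracy_def)
      \<comment> \<open>The argument holds for any set of worlds and any enumeration, hence also on
        the compactification.\<close>
      then have "\<not> weakly_dominated (star_worlds W p) (range (star_enum W p))
          (inaccuracy (star_enum W p) a \<dd>) (star_credence W p c)"
        by (rule not_weakly_dominated) (rule assms(4))
      then show ?thesis
        using assms(6) c coh unfolding W_stable_def F by blast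
    qed
  next
    assume "\<not> weakly_dominated W F (inaccuracy p a \<dd>) c"
    then show "coherent W F c"
      using weakly_dominated_if_incoherent[where a = a, OF W \<open>inj p\<close> assms(4)] c unfolding F by blast
  qed
qed

end
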